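(* There is a computable coloring $c:\mathcal{P}_{fin}(\mathbb{N})\rightarrow\{0,1\}$ such that for every finite $\mathcal{B}\subseteq\mathcal{P}_{fin}(\mathbb{N})$ and every computably enumerable $\mathcal{S}\subseteq\mathcal{P}_{fin}(\mathbb{N})$ containing infinitely many pairwise disjoint elements, $\mathcal{B}$ does not full-match $NU(\mathcal{S})$; that is, there is $T\in NU(\mathcal{S})$ such that there is no $B\in\mathcal{B}$ with $\max B<\min T$ and $c(B)=c(T)=c(B\cup T)$.
   Context: $\mathcal{P}_{fin}(\mathbb{N})$ is the set of finite subsets of $\mathbb{N}$, identified with $\mathbb{N}$ via a fixed computable bijection; computability and computable enumerability are with respect to this identification. For $\mathcal{S}\subseteq\mathcal{P}_{fin}(\mathbb{N})$, $NU(\mathcal{S})$ denotes the set of non-empty sets which are unions of finitely many elements of $\mathcal{S}$. Convention in this setting: a union $B\cup T$ of two finite sets is only considered when $\max B<\min T$. Relative to $c$: a family $\mathcal{B}$ full-matches a set $T$ if there is $B\in\mathcal{B}$ with $\max B<\min T$ and $c(B)=c(T)=c(B\cup T)$, and full-matches a family if it full-matches each member. *)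

theory Defs
  imports Main "HOL-Library.Nat_Bijection"
begin

datatype recf =
    Zero
  | Succ
  | Proj nat
  | Comp recf "recf list"
  | Prec recf recf
  | Mu recf

inductive eval :: "recf \<Rightarrow> nat list \<Rightarrow> nat \<Rightarrow> bool" where
  eval_Zero: "eval Zero xs 0"
| eval_Succ: "eval Succ (x # xs) (Suc x)"
| eval_Proj: "i < length xs \<Longrightarrow> eval (Proj i) xs (xs ! i)"
| eval_Comp: "list_all2 (\<lambda>g y. eval g xs y) gs ys \<Longrightarrow> eval f ys z
      \<Longrightarrow> eval (Comp f gs) xs z"
| eval_Prec0: "eval f xs y \<Longrightarrow> eval (Prec f g) (0 # xs) y"
| eval_PrecS: "eval (Prec f g) (n # xs) y \<Longrightarrow> eval g (n # y # xs) z
      \<Longrightarrow> eval (Prec f g) (Suc n # xs) z"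
| eval_Mu: "eval f (n # xs) 0 \<Longrightarrow> (\<forall>m<n. \<exists>y. eval f (m # xs) (Suc y))
      \<Longrightarrow> eval (Mu f) xs n"

definition computable_fun :: "(nat \<Rightarrow> nat) \<Rightarrow> bool" where
  "computable_fun h \<longleftrightarrow> (\<exists>p. \<forall>n. eval p [n] (h n))"

definition ce_set :: "nat set \<Rightarrow> bool" where
  "ce_set A \<longleftrightarrow> (\<exists>p. \<forall>n. n \<in> A \<longleftrightarrow> (\<exists>y. eval p [n] y))"

definition computable_coloring :: "(nat set \<Rightarrow> nat) \<Rightarrow> bool" where
  "computable_coloring c \<longleftrightarrow>
     (\<forall>F. finite F \<longrightarrow> c F < 2) \<and>
     (\<exists>h. computable_fun h \<and> (\<forall>F. finite F \<longrightarrow> h (set_encode F) = c F))"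

definition ce_family :: "nat set set \<Rightarrow> bool" where
  "ce_family S \<longleftrightarrow> (\<forall>s\<in>S. finite s) \<and> ce_set (set_encode ` S)"

definition blk_less :: "nat set \<Rightarrow> nat set \<Rightarrow> bool" where
  "blk_less B T \<longleftrightarrow> B \<noteq> {} \<and> T \<noteq> {} \<and> Max B < Min T"

definition NU :: "nat set set \<Rightarrow> nat set set" where
  "NU S = {T. T \<noteq> {} \<and> (\<exists>xs. xs \<noteq> [] \<and> set xs \<subseteq> S \<and> T = \<Union>(set xs) \<and>
              sorted_wrt (\<lambda>A B. \<forall>a\<in>A. \<forall>b\<in>B. a < b) xs)}"

definition full_matches_set :: "(nat set \<Rightarrow> nat) \<Rightarrow> nat set set \<Rightarrow> nat set \<Rightarrow> bool" where
  "full_matches_set c \<B> T \<longleftrightarrow>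
     (\<exists>B\<in>\<B>. blk_less B T \<and> c B = c T \<and> c T = c (B \<union> T))"

definition full_matches :: "(nat set \<Rightarrow> nat) \<Rightarrow> nat set set \<Rightarrow> nat set set \<Rightarrow> bool" where
  "full_matches c \<B> \<T> \<longleftrightarrow> (\<forall>T\<in>\<T>. full_matches_set c \<B> T)"

end

theory Submission
  imports Defs
begin

text \<open>
  Write \<open>W_e\<close> for the \<open>e\<close>-th c.e. family of finite sets. For every \<open>r = \<langle>e, k\<rangle>\<close> let \<open>T_r\<close> be the
  first nonempty member of \<open>W_e\<close> found with \<open>r \<le> min T_r\<close>. The coloring is based on a count \<open>h\<close>
  of certain gaps: a gap \<open>(x, y)\<close> of \<open>X\<close> is a hit if, for the least \<open>r\<close> such that \<open>T_r\<close> is found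
  by stage \<open>y\<close> and \<open>X \<inter> [r, x] = T_r\<close>, the value \<open>h(T_r)\<close> is divisible by 3. The color of \<open>X\<close>
  is 1 if \<open>h(X)\<close> is 1 modulo 3, and 0 otherwise.

  If \<open>T\<close> starts far enough beyond \<open>B\<close>, the finitely many \<open>T_r\<close> with \<open>r \<le> max B\<close> lie below
  \<open>min T\<close> and so do not affect the gaps of \<open>T\<close>; hence \<open>h(B \<union> T) = h(B) + \<delta> + h(T)\<close>, where
  \<open>\<delta> \<in> {0, 1}\<close> tells whether the gap between \<open>B\<close> and \<open>T\<close> is a hit. If \<open>B\<close> and \<open>T\<close> have color 1,
  then \<open>h(B \<union> T)\<close> is 2 or 0 modulo 3, so \<open>T\<close> of color 1 is not full-matched by \<open>B\<close>.

  It remains to find members of \<open>NU(S)\<close> of color 1 far out. Take \<open>T\<^sub>1 < T\<^sub>2 < Y\<close> in \<open>S\<close>,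
  far apart, with \<open>T\<^sub>1\<close> and \<open>T\<^sub>2\<close> among the \<open>T_r\<close>. If neither \<open>T\<^sub>i\<close> has color 1, putting \<open>T\<^sub>i\<close>
  in front of a later set adds 1 or 2 to \<open>h\<close> modulo 3, and then one of \<open>Y\<close>, \<open>T\<^sub>1 \<union> Y\<close>,
  \<open>T\<^sub>2 \<union> Y\<close>, \<open>T\<^sub>1 \<union> T\<^sub>2 \<union> Y\<close> has color 1.
\<close>

section \<open>Recursive programs\<close>

lemma eval_Comp1: "eval g xs a \<Longrightarrow> eval f [a] z \<Longrightarrow> eval (Comp f [g]) xs z"
  by (rule eval_Comp[of _ _ "[a]"]) auto

lemma eval_Comp2:
  "eval g xs a \<Longrightarrow> eval h xs b \<Longrightarrow> eval f [a, b] z \<Longrightarrow> eval (Comp f [g, h]) xs z"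
  by (rule eval_Comp[of _ _ "[a, b]"]) auto

lemma eval_Proj_0: "eval (Proj 0) (x # xs) x"
  using eval_Proj[of 0 "x # xs"] by simp

lemma eval_Proj_1: "eval (Proj 1) (x # y # xs) y"
  using eval_Proj[of 1 "x # y # xs"] by simp

lemma eval_Proj_2: "eval (Proj 2) (x # y # z # xs) z"
  using eval_Proj[of 2 "x # y # z # xs"] by simp

lemmas eval_rules = eval_Zero eval_Succ eval_Proj_0 eval_Proj_1 eval_Proj_2 eval_Comp1 eval_Comp2

definition recf_add :: recf where
  "recf_add = Prec (Proj 0) (Comp Succ [Proj 1])"

lemma eval_recf_add: "eval recf_add [m, n] (m + n)"
proof (induction m)
  case 0
  then show ?case
    unfolding recf_add_def by (auto intro!: eval_Prec0 eval_rules)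
next
  case (Suc m)
  have "eval (Comp Succ [Proj 1]) [m, m + n, n] (Suc (m + n))"
    by (rule eval_rules)+
  with Suc show ?case
    unfolding recf_add_def by (auto intro: eval_PrecS)
qed

definition recf_pred :: recf where
  "recf_pred = Prec Zero (Proj 0)"

lemma eval_recf_pred: "eval recf_pred [n] (n - 1)"
proof (induction n)
  case 0
  then show ?case
    unfolding recf_pred_def by (auto intro!: eval_Prec0 eval_rules)
next
  case (Suc n)
  then show ?case
    unfolding recf_pred_def by (auto intro!: eval_PrecS eval_rules)
qed

text \<open>The arguments are swapped because \<open>Prec\<close> recurses on its first argument,
  here the subtrahend.\<close>

definition recf_rsub :: recf where
  "recf_rsub = Prec (Proj 0) (Comp recf_pred [Proj 1])"

lemma eval_recf_rsub: "eval recf_rsub [m, n] (n - m)"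
proof (induction m)
  case 0
  then show ?case
    unfolding recf_rsub_def by (auto intro!: eval_Prec0 eval_rules)
next
  case (Suc m)
  have "eval recf_pred [n - m] (n - Suc m)"
    using eval_recf_pred[of "n - m"] by simp
  then have "eval (Comp recf_pred [Proj 1]) [m, n - m, n] (n - Suc m)"
    by (rule eval_Comp1[OF eval_Proj_1])
  with Suc show ?case
    unfolding recf_rsub_def by (auto intro: eval_PrecS)
qed

definition recf_triangle :: recf where
  "recf_triangle = Prec Zero (Comp Succ [Comp recf_add [Proj 0, Proj 1]])"

lemma eval_recf_triangle: "eval recf_triangle [n] (triangle n)"
proof (induction n)
  case 0
  then show ?case
    unfolding recf_triangle_def by (auto intro!: eval_Prec0 eval_rules)
next
  case (Suc n)
  have "eval (Comp Succ [Comp recf_add [Proj 0, Proj 1]]) [n, triangle n] (Suc (n + triangle n))"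
    by (rule eval_rules eval_recf_add)+
  with Suc show ?case
    unfolding recf_triangle_def by (auto intro!: eval_PrecS simp: add.commute)
qed

definition recf_pair :: recf where
  "recf_pair = Comp recf_add [Comp recf_triangle [recf_add], Proj 0]"

lemma eval_recf_pair: "eval recf_pair [m, n] (prod_encode (m, n))"
  unfolding recf_pair_def prod_encode_def
  by (simp, (rule eval_rules eval_recf_add eval_recf_triangle)+)

text \<open>On the code of a pair \<open>(m, n)\<close> this finds the index \<open>m + n\<close> of its antidiagonal.\<close>

definition recf_diag :: recf where
  "recf_diag = Mu (Comp recf_rsub [Comp recf_triangle [Comp Succ [Proj 0]], Comp Succ [Proj 1]])"

lemma triangle_mono: "i \<le> j \<Longrightarrow> triangle i \<le> triangle j"
  by (induction rule: dec_induct) auto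

lemma eval_recf_diag: "eval recf_diag [prod_encode (m, n)] (m + n)"
proof -
  let ?z = "prod_encode (m, n)"
  let ?p = "Comp recf_rsub [Comp recf_triangle [Comp Succ [Proj 0]], Comp Succ [Proj 1]]"
  \<comment> \<open>Truncated subtraction vanishes iff \<open>?z < triangle (Suc w)\<close>. As
    \<open>?z = triangle (m + n) + m\<close>, the least such \<open>w\<close> is
    \<open>m + n\<close>.\<close>
  have p: "eval ?p [w, ?z] (Suc ?z - triangle (Suc w))" for w
    by (rule eval_rules eval_recf_rsub eval_recf_triangle)+
  have "eval ?p [m + n, ?z] 0"
    using p[of "m + n"] by (simp add: prod_encode_def)
  moreover have "\<exists>y. eval ?p [w, ?z] (Suc y)" if "w < m + n" for w
  proof -
    have "triangle (Suc w) < Suc ?z"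
      using triangle_mono[of "Suc w" "m + n"] that by (simp add: prod_encode_def)
    then have "Suc ?z - triangle (Suc w) = Suc (?z - triangle (Suc w))"
      by linarith
    with p[of w] show ?thesis by metis
  qed
  ultimately show ?thesis
    unfolding recf_diag_def by (auto intro!: eval_Mu)
qed

definition recf_fst :: recf where
  "recf_fst = Comp recf_rsub [Comp recf_triangle [recf_diag], Proj 0]"

definition recf_snd :: recf where
  "recf_snd = Comp recf_rsub [recf_fst, recf_diag]"

lemma eval_recf_fst: "eval recf_fst [prod_encode (m, n)] m"
proof -
  have "eval recf_fst [prod_encode (m, n)] (prod_encode (m, n) - triangle (m + n))"
    unfolding recf_fst_def
    by (rule eval_rules eval_recf_rsub eval_recf_triangle eval_recf_diag)+
  then show ?thesis by (simp add: prod_encode_def)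
qed

lemma eval_recf_snd: "eval recf_snd [prod_encode (m, n)] n"
proof -
  have "eval recf_snd [prod_encode (m, n)] (m + n - m)"
    unfolding recf_snd_def
    by (rule eval_rules eval_recf_rsub eval_recf_fst eval_recf_diag)+
  then show ?thesis by simp
qed

section \<open>Computability over encodable types\<close>

text \<open>A concrete injective code for each type lets \<open>computable\<close> speak of typed
  functions, so that the coloring can be shown computable by the closure rules
  \<open>computable_intros\<close>.\<close>

class encodable =
  fixes enc :: "'a \<Rightarrow> nat"
  assumes inj_enc: "inj enc"

lemma enc_eq_iff [simp]: "enc x = enc y \<longleftrightarrow> x = y"
  by (simp add: inj_enc inj_eq)

instantiation nat :: encodable
begin
definition enc_nat :: "nat \<Rightarrow> nat" where [simp]: "enc_nat n = n"
instance by standard (simp add: inj_on_def)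
end

instantiation bool :: encodable
begin
definition enc_bool :: "bool \<Rightarrow> nat" where "enc_bool = of_bool"
instance by standard (simp add: inj_on_def enc_bool_def)
end

instantiation prod :: (encodable, encodable) encodable
begin
definition enc_prod :: "'a \<times> 'b \<Rightarrow> nat" where
  "enc_prod x = prod_encode (enc (fst x), enc (snd x))"
instance by standard (simp add: inj_on_def enc_prod_def prod_eq_iff)
end

instantiation list :: (encodable) encodable
begin
definition enc_list :: "'a list \<Rightarrow> nat" where
  "enc_list xs = list_encode (map enc xs)"
instance
proof
  show "inj (enc :: 'a list \<Rightarrow> nat)"
    unfolding inj_on_def enc_list_def
    using inj_enc by (auto simp: list_encode_eq dest: map_injective)
qed
end

lemma enc_Nil [simp]: "enc ([] :: 'a::encodable list) = 0"
  by (simp add: enc_list_def)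

lemma enc_Cons: "enc (x # xs) = Suc (prod_encode (enc x, enc xs))"
  by (simp add: enc_list_def)

lemma length_le_enc: "length xs \<le> enc xs"
proof (induction xs)
  case (Cons x xs)
  then show ?case
    using le_prod_encode_2[of "enc xs" "enc x"] by (simp add: enc_Cons)
qed simp

lemma enc_list_decode [simp]: "enc (list_decode n) = n"
proof -
  have "map enc ns = ns" for ns :: "nat list"
    by (induction ns) auto
  then show ?thesis by (simp add: enc_list_def)
qed

definition computable :: "('a::encodable \<Rightarrow> 'b::encodable) \<Rightarrow> bool" where
  "computable f \<longleftrightarrow> (\<exists>p. \<forall>x. eval p [enc x] (enc (f x)))"

lemma computableI: "(\<And>x. eval p [enc x] (enc (f x))) \<Longrightarrow> computable f"
  unfolding computable_def by blast

text \<open>A program sees only codes, so it also serves a function with another result type. This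
  settles decoders such as \<open>prod_decode\<close>, whose result has the argument itself as its
  code.\<close>

lemma computable_cong_enc:
  assumes "computable g" and "\<And>x. enc (f x) = enc (g x)"
  shows "computable f"
  using assms unfolding computable_def by simp

named_theorems computable_intros

lemma computable_id [computable_intros]: "computable (\<lambda>x. x)"
  by (rule computableI[of "Proj 0"]) (rule eval_rules)

lemma computable_const [computable_intros]: "computable (\<lambda>x. c)"
proof -
  have "\<exists>p. \<forall>xs. eval p xs n" for n
  proof (induction n)
    case (Suc n)
    then show ?case by (metis eval_Comp1 eval_Succ)
  qed (use eval_Zero in blast)
  then show ?thesis unfolding computable_def by blast
qed

lemma computable_compose:
  assumes "computable f" "computable g"
  shows "computable (\<lambda>x. f (g x))"
  using assms unfolding computable_def by (meson eval_Comp1)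

lemma computable_Pair [computable_intros]:
  assumes "computable f" "computable g"
  shows "computable (\<lambda>x. (f x, g x))"
proof -
  obtain p q where pq: "\<And>x. eval p [enc x] (enc (f x))" "\<And>x. eval q [enc x] (enc (g x))"
    using assms unfolding computable_def by blast
  show ?thesis
    by (rule computableI[of "Comp recf_pair [p, q]"])
      (auto simp: enc_prod_def intro!: eval_Comp2 eval_recf_pair pq)
qed

lemma computable_curry:
  assumes "computable (\<lambda>p. F (fst p) (snd p))" "computable f" "computable g"
  shows "computable (\<lambda>x. F (f x) (g x))"
  using computable_compose[OF assms(1) computable_Pair[OF assms(2,3)]] by simp

lemma computable_fst [computable_intros]: "computable f \<Longrightarrow> computable (\<lambda>x. fst (f x))"
  by (rule computable_compose[of fst], rule computableI[of recf_fst])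
    (auto simp: enc_prod_def intro: eval_recf_fst)

lemma computable_snd [computable_intros]: "computable f \<Longrightarrow> computable (\<lambda>x. snd (f x))"
  by (rule computable_compose[of snd], rule computableI[of recf_snd])
    (auto simp: enc_prod_def intro: eval_recf_snd)

lemma computable_prod_encode [computable_intros]:
  "computable f \<Longrightarrow> computable (\<lambda>x. prod_encode (f x))"
  by (erule computable_cong_enc) (simp add: enc_prod_def)

lemma computable_prod_decode [computable_intros]:
  "computable f \<Longrightarrow> computable (\<lambda>x. prod_decode (f x))"
  by (erule computable_cong_enc) (simp add: enc_prod_def)

lemma computable_list_decode [computable_intros]:
  "computable f \<Longrightarrow> computable (\<lambda>x. list_decode (f x))"
  by (erule computable_cong_enc) simp

lemma computable_enc [computable_intros]:
  "computable f \<Longrightarrow> computable (\<lambda>x. enc (f x))"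
  by (erule computable_cong_enc) simp

section \<open>Closure under recursion, case distinction and connectives\<close>

lemma computable_rec_nat [computable_intros]:
  fixes f :: "'a::encodable \<Rightarrow> 'b::encodable"
  assumes "computable f" "computable (\<lambda>p. g (fst p) (fst (snd p)) (snd (snd p)))" "computable h"
  shows "computable (\<lambda>x. rec_nat (f x) (g x) (h x))"
proof -
  let ?g = "\<lambda>p. g (fst p) (fst (snd p)) (snd (snd p))"
  obtain p q r where
    p: "\<And>x. eval p [enc x] (enc (f x))" and
    q: "\<And>x n y. eval q [prod_encode (enc x, prod_encode (n, enc y))] (enc (g x n y))" and
    r: "\<And>x. eval r [enc x] (h x)"
    using assms unfolding computable_def enc_prod_def by fastforce
  \<comment> \<open>\<open>Prec\<close> supplies counter, previous value and parameter;
    \<open>?G\<close> packs them into the nested pair, parameter first, that \<open>q\<close>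
    expects.\<close>
  let ?G = "Comp q [Comp recf_pair [Proj 2, Comp recf_pair [Proj 0, Proj 1]]]"
  have "eval (Prec p ?G) [n, enc x] (enc (rec_nat (f x) (g x) n))" for n x
  proof (induction n)
    case 0
    then show ?case by (auto intro!: eval_Prec0 p)
  next
    case (Suc n)
    have "eval ?G [n, enc (rec_nat (f x) (g x) n), enc x] (enc (g x n (rec_nat (f x) (g x) n)))"
      by (rule eval_Comp1, rule eval_Comp2, rule eval_Proj_2, rule eval_Comp2, rule eval_Proj_0,
          rule eval_Proj_1, rule eval_recf_pair, rule eval_recf_pair, rule q)
    with Suc show ?case by (auto intro: eval_PrecS)
  qed
  then have "eval (Comp (Prec p ?G) [r, Proj 0]) [enc x] (enc (rec_nat (f x) (g x) (h x)))" for x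
    by (rule eval_Comp2[OF r eval_Proj_0])
  then show ?thesis by (rule computableI)
qed

lemma computable_if [computable_intros]:
  assumes "computable P" "computable f" "computable g"
  shows "computable (\<lambda>x. if P x then f x else g x)"
proof -
  have "(\<lambda>x. if P x then f x else g x) = (\<lambda>x. rec_nat (g x) (\<lambda>_ _. f x) (enc (P x)))"
    by (auto simp: enc_bool_def)
  then show ?thesis
    by (simp only:) (intro computable_intros assms computable_compose[OF assms(2)])
qed

lemma computable_Not [computable_intros]:
  assumes "computable P"
  shows "computable (\<lambda>x. \<not> P x)"
proof -
  have "(\<lambda>x. \<not> P x) = (\<lambda>x. if P x then False else True)"
    by auto
  then show ?thesis
    by (simp only:) (intro computable_intros assms)
qed

lemma computable_conj [computable_intros]:
  assumes "computable P" "computable Q"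
  shows "computable (\<lambda>x. P x \<and> Q x)"
proof -
  have "(\<lambda>x. P x \<and> Q x) = (\<lambda>x. if P x then Q x else False)"
    by auto
  then show ?thesis
    by (simp only:) (intro computable_intros assms)
qed

lemma computable_disj [computable_intros]:
  assumes "computable P" "computable Q"
  shows "computable (\<lambda>x. P x \<or> Q x)"
proof -
  have "(\<lambda>x. P x \<or> Q x) = (\<lambda>x. if P x then True else Q x)"
    by auto
  then show ?thesis
    by (simp only:) (intro computable_intros assms)
qed

section \<open>Arithmetic, comparisons and search\<close>

lemma computable_Suc [computable_intros]:
  "computable f \<Longrightarrow> computable (\<lambda>x. Suc (f x))"
  by (rule computable_compose[of Suc], rule computableI[of Succ])
    (auto intro: eval_rules)

lemma computable_add [computable_intros]:
  fixes f g :: "'a::encodable \<Rightarrow> nat"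
  assumes "computable f" "computable g"
  shows "computable (\<lambda>x. f x + g x)"
proof -
  have "m + n = rec_nat n (\<lambda>_. Suc) m" for m n :: nat
    by (induction m) auto
  then show ?thesis by (simp only:) (intro computable_intros assms)
qed

lemma computable_diff [computable_intros]:
  fixes f g :: "'a::encodable \<Rightarrow> nat"
  assumes "computable f" "computable g"
  shows "computable (\<lambda>x. f x - g x)"
proof -
  have pred: "rec_nat 0 (\<lambda>i _. i) n = n - 1" for n :: nat
    by (cases n) auto
  have "m - n = rec_nat m (\<lambda>_. rec_nat 0 (\<lambda>i _. i)) n" for m n :: nat
    by (induction n) (auto simp: pred)
  then show ?thesis by (simp only:) (intro computable_intros assms)
qed

lemma computable_mult [computable_intros]:
  fixes f g :: "'a::encodable \<Rightarrow> nat"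
  assumes "computable f" "computable g"
  shows "computable (\<lambda>x. f x * g x)"
proof -
  have "m * n = rec_nat 0 (\<lambda>_ y. y + n) m" for m n :: nat
    by (induction m) auto
  then show ?thesis
    by (simp only:) (intro computable_intros assms computable_compose[OF assms(2)])
qed

lemma computable_power [computable_intros]:
  fixes f g :: "'a::encodable \<Rightarrow> nat"
  assumes "computable f" "computable g"
  shows "computable (\<lambda>x. f x ^ g x)"
proof -
  have "m ^ n = rec_nat 1 (\<lambda>_ y. y * m) n" for m n :: nat
    by (induction n) auto
  then show ?thesis
    by (simp only:) (intro computable_intros assms computable_compose[OF assms(1)])
qed

lemma computable_eq [computable_intros]:
  fixes f g :: "'a::encodable \<Rightarrow> 'b::encodable"
  assumes "computable f" "computable g"
  shows "computable (\<lambda>x. f x = g x)"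
proof -
  have "x = y \<longleftrightarrow> rec_nat True (\<lambda>_ _. False) ((enc x - enc y) + (enc y - enc x))" for x y :: 'b
  proof (cases "x = y")
    case False
    then have "enc x \<noteq> enc y" by simp
    then obtain k where "(enc x - enc y) + (enc y - enc x) = Suc k"
      by (cases "(enc x - enc y) + (enc y - enc x)") auto
    with False show ?thesis by simp
  qed simp
  then show ?thesis by (simp only:) (intro computable_intros assms)
qed

lemma computable_le [computable_intros]:
  fixes f g :: "'a::encodable \<Rightarrow> nat"
  assumes "computable f" "computable g"
  shows "computable (\<lambda>x. f x \<le> g x)"
proof -
  have "(\<lambda>x. f x \<le> g x) = (\<lambda>x. f x - g x = 0)"
    by auto
  then show ?thesis by (simp only:) (intro computable_intros assms)
qed

lemma computable_less [computable_intros]: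
  fixes f g :: "'a::encodable \<Rightarrow> nat"
  assumes "computable f" "computable g"
  shows "computable (\<lambda>x. f x < g x)"
proof -
  have "(\<lambda>x. f x < g x) = (\<lambda>x. Suc (f x) \<le> g x)"
    by auto
  then show ?thesis by (simp only:) (intro computable_intros assms)
qed

text \<open>Since a witness exists for every \<open>x\<close>, the search by \<open>Mu\<close>
  halts. \<open>Mu\<close> looks for a zero, so the program being searched decides the negation of
  \<open>P\<close>.\<close>

lemma computable_Least [computable_intros]:
  fixes P :: "'a::encodable \<Rightarrow> nat \<Rightarrow> bool"
  assumes "computable (\<lambda>p. P (fst p) (snd p))" and ex: "\<And>x. \<exists>n. P x n"
  shows "computable (\<lambda>x. LEAST n. P x n)"
proof -
  have "computable (\<lambda>p. enc (\<not> P (fst p) (snd p)))"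
    by (intro computable_intros assms)
  then obtain q where q: "\<And>x n. eval q [prod_encode (enc x, n)] (of_bool (\<not> P x n))"
    unfolding computable_def enc_prod_def enc_bool_def by fastforce
  let ?q = "Comp q [Comp recf_pair [Proj 1, Proj 0]]"
  have "eval (Mu ?q) [enc x] (LEAST n. P x n)" for x
  proof (rule eval_Mu)
    have q': "eval ?q [n, enc x] (of_bool (\<not> P x n))" for n
      by (rule eval_Comp1, rule eval_Comp2, rule eval_Proj_1, rule eval_Proj_0,
          rule eval_recf_pair, rule q)
    show "eval ?q [LEAST n. P x n, enc x] 0"
      using q'[of "LEAST n. P x n"] LeastI_ex[OF ex[of x]] by simp
    show "\<forall>m<LEAST n. P x n. \<exists>y. eval ?q [m, enc x] (Suc y)"
    proof (intro allI impI)
      fix m assume "m < (LEAST n. P x n)"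
      then have "\<not> P x m" by (rule not_less_Least)
      then show "\<exists>y. eval ?q [m, enc x] (Suc y)"
        using q'[of m] by auto
    qed
  qed
  then show ?thesis by (intro computableI) auto
qed

lemma computable_bex_less [computable_intros]:
  fixes P :: "'a::encodable \<Rightarrow> nat \<Rightarrow> bool"
  assumes "computable (\<lambda>p. P (fst p) (snd p))" "computable b"
  shows "computable (\<lambda>x. \<exists>i<b x. P x i)"
proof -
  have "(\<exists>i<n. P x i) = rec_nat False (\<lambda>i a. a \<or> P x i) n" for n x
    by (induction n) (auto simp: less_Suc_eq)
  then show ?thesis
    by (simp only:)
      (intro computable_intros assms computable_compose[OF assms(1), of "\<lambda>p. (fst p, fst (snd p))", simplified])
qed

lemma computable_ball_less [computable_intros]:
  fixes P :: "'a::encodable \<Rightarrow> nat \<Rightarrow> bool"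
  assumes "computable (\<lambda>p. P (fst p) (snd p))" "computable b"
  shows "computable (\<lambda>x. \<forall>i<b x. P x i)"
proof -
  have "(\<forall>i<b x. P x i) \<longleftrightarrow> \<not> (\<exists>i<b x. \<not> P x i)" for x
    by auto
  then show ?thesis by (simp only:) (intro computable_intros assms)
qed

lemma computable_div [computable_intros]:
  fixes f g :: "'a::encodable \<Rightarrow> nat"
  assumes "computable f" "computable g"
  shows "computable (\<lambda>x. f x div g x)"
proof -
  \<comment> \<open>The disjunct \<open>n = 0\<close> yields the value 0 of \<open>m div 0\<close>
    and lets the search terminate there.\<close>
  have *: "m div n = (LEAST q. n = 0 \<or> m < Suc q * n)" for m n :: nat
  proof (cases "n = 0")
    case False
    then show ?thesis
      by (intro Least_equality[symmetric])
        (auto simp: dividend_less_div_times less_mult_imp_div_less less_Suc_eq_le[symmetric])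
  qed (simp add: Least_eq_0)
  have "\<exists>q. n = 0 \<or> m < Suc q * n" for m n :: nat
    using lessI[of m] by (metis less_Suc_eq_le mult_le_mono2 mult.commute mult.right_neutral
        not_less_eq_eq One_nat_def Suc_leI neq0_conv order.strict_trans2)
  with * show ?thesis
    by (simp only:)
      (intro computable_intros computable_compose[OF assms(1)] computable_compose[OF assms(2)])
qed

lemma computable_mod [computable_intros]:
  fixes f g :: "'a::encodable \<Rightarrow> nat"
  assumes "computable f" "computable g"
  shows "computable (\<lambda>x. f x mod g x)"
  unfolding modulo_nat_def by (intro computable_intros assms)

section \<open>List operations\<close>

lemma computable_Cons [computable_intros]:
  assumes "computable f" "computable g"
  shows "computable (\<lambda>x. f x # g x)"
proof -
  have "computable (\<lambda>x. Suc (prod_encode (enc (f x), enc (g x))))"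
    by (intro computable_intros assms)
  then show ?thesis by (rule computable_cong_enc) (simp add: enc_Cons)
qed

lemma computable_tl [computable_intros]:
  assumes "computable f"
  shows "computable (\<lambda>x. tl (f x))"
proof -
  have c: "computable (\<lambda>x. snd (prod_decode (enc (f x) - 1)))"
    by (intro computable_intros assms)
  \<comment> \<open>Covers the empty list: its code 0 must yield 0 again, the code of
    \<open>tl []\<close>.\<close>
  have "prod_decode 0 = (0, 0)"
    using prod_encode_inverse[of "(0, 0)"] by (simp add: prod_encode_def)
  then have "enc (tl xs) = snd (prod_decode (enc xs - 1))" for xs :: "'b list"
    by (cases xs) (auto simp: enc_Cons)
  then show ?thesis by (intro computable_cong_enc[OF c]) simp
qed

lemma computable_hd [computable_intros]:
  fixes f :: "'a::encodable \<Rightarrow> 'b::encodable list"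
  assumes "computable f"
  shows "computable (\<lambda>x. hd (f x))"
proof -
  have c: "computable (\<lambda>x. if f x = [] then enc (hd [] :: 'b) else fst (prod_decode (enc (f x) - 1)))"
    by (intro computable_intros assms)
  have "enc (hd xs) = (if xs = [] then enc (hd [] :: 'b) else fst (prod_decode (enc xs - 1)))"
    for xs :: "'b list"
    by (cases xs) (auto simp: enc_Cons)
  then show ?thesis by (intro computable_cong_enc[OF c]) simp
qed

lemma computable_fold [computable_intros]:
  fixes F :: "'a::encodable \<Rightarrow> 'b::encodable \<Rightarrow> 'c::encodable \<Rightarrow> 'c"
  assumes F: "computable (\<lambda>p. F (fst p) (fst (snd p)) (snd (snd p)))"
    and "computable l" "computable a"
  shows "computable (\<lambda>x. fold (F x) (l x) (a x))"
proof -
  define step where "step = (\<lambda>x (p :: 'b list \<times> 'c).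
    if fst p = [] then p else (tl (fst p), F x (hd (fst p)) (snd p)))"
  have *: "snd (rec_nat (xs, c) (\<lambda>_. step x) n) = fold (F x) xs c" if "length xs \<le> n" for x xs c n
  proof -
    have "rec_nat (xs, c) (\<lambda>_. step x) n = (drop n xs, fold (F x) (take n xs) c)" for n
    proof (induction n)
      case (Suc n)
      then show ?case
        by (auto simp: step_def take_Suc_conv_app_nth hd_drop_conv_nth drop_Suc tl_drop)
    qed simp
    with that show ?thesis by simp
  qed
  have "computable (\<lambda>p. F (fst p) (hd (fst (snd (snd p)))) (snd (snd (snd p))))"
    using computable_compose[OF F,
      of "\<lambda>p. (fst p, hd (fst (snd (snd p))), snd (snd (snd p)))"]
    by (simp add: computable_intros)
  \<comment> \<open>The code of the list bounds its length, so \<open>enc (l x)\<close> rounds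
    suffice; surplus rounds are idle because \<open>step\<close> fixes a pair with empty
    list.\<close>
  then have "computable (\<lambda>x. snd (rec_nat (l x, a x) (\<lambda>_. step x) (enc (l x))))"
    unfolding step_def by (intro computable_intros assms(2,3))
  then show ?thesis by (simp add: * length_le_enc)
qed

lemma computable_rev [computable_intros]:
  assumes "computable f"
  shows "computable (\<lambda>x. rev (f x))"
proof -
  have "rev xs = fold (\<lambda>y ys. y # ys) xs []" for xs :: "'b list"
    by (simp add: rev_conv_fold)
  then show ?thesis by (simp only:) (intro computable_intros assms)
qed

lemma computable_append [computable_intros]:
  assumes "computable f" "computable g"
  shows "computable (\<lambda>x. f x @ g x)"
proof -
  have "xs @ ys = fold (\<lambda>z zs. z # zs) (rev xs) ys" for xs ys :: "'b list"
    by (simp add: fold_Cons_rev)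
  then show ?thesis by (simp only:) (intro computable_intros assms)
qed

lemma computable_length [computable_intros]:
  assumes "computable f"
  shows "computable (\<lambda>x. length (f x))"
proof -
  have "fold (\<lambda>_. Suc) xs n = length xs + n" for xs :: "'b list" and n
    by (induction xs arbitrary: n) auto
  then have "length xs = fold (\<lambda>_. Suc) xs 0" for xs :: "'b list"
    by simp
  then show ?thesis by (simp only:) (intro computable_intros assms)
qed

lemma computable_drop [computable_intros]:
  assumes "computable n" "computable f"
  shows "computable (\<lambda>x. drop (n x) (f x))"
proof -
  have "drop k xs = rec_nat xs (\<lambda>_. tl) k" for k and xs :: "'b list"
    by (induction k) (auto simp: drop_Suc simp flip: tl_drop)
  then show ?thesis by (simp only:) (intro computable_intros assms)
qed

lemma computable_bex_set [computable_intros]: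
  assumes P: "computable (\<lambda>p. P (fst p) (snd p))" and "computable l"
  shows "computable (\<lambda>x. \<exists>y\<in>set (l x). P x y)"
proof -
  have "fold (\<lambda>y a. a \<or> P x y) xs a \<longleftrightarrow> a \<or> (\<exists>y\<in>set xs. P x y)" for x xs a
    by (induction xs arbitrary: a) auto
  then have "(\<exists>y\<in>set xs. P x y) \<longleftrightarrow> fold (\<lambda>y a. a \<or> P x y) xs False" for x xs
    by simp
  then show ?thesis
    by (simp only:)
      (intro computable_intros assms computable_compose[OF P, of "\<lambda>p. (fst p, fst (snd p))", simplified])
qed

lemma computable_member [computable_intros]:
  assumes "computable f" "computable l"
  shows "computable (\<lambda>x. f x \<in> set (l x))"
proof -
  have "y \<in> set ys \<longleftrightarrow> (\<exists>z\<in>set ys. z = y)" for y :: 'b and ys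
    by auto
  then show ?thesis
    by (simp only:) (intro computable_intros assms computable_compose[OF assms(1)])
qed

section \<open>Enumerating all computations\<close>

primrec code :: "recf \<Rightarrow> nat" where
  "code Zero = prod_encode (0, 0)"
| "code Succ = prod_encode (1, 0)"
| "code (Proj i) = prod_encode (2, i)"
| "code (Comp f gs) = prod_encode (3, prod_encode (code f, list_encode (map code gs)))"
| "code (Prec f g) = prod_encode (4, prod_encode (code f, code g))"
| "code (Mu f) = prod_encode (5, code f)"

type_synonym fact = "nat \<times> nat list \<times> nat"

text \<open>
  A fact \<open>(p, xs, y)\<close> asserts that the program coded by \<open>p\<close> maps \<open>xs\<close> to \<open>y\<close>. Programs stay
  coded as numbers so that every number codes a fact; codes of no program are harmless,
  since a program is only ever justified through its subprograms.
\<close>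

definition justified :: "fact list \<Rightarrow> nat \<Rightarrow> nat list \<Rightarrow> nat \<Rightarrow> bool" where
  "justified D p xs y \<longleftrightarrow>
    (let t = fst (prod_decode p); r = snd (prod_decode p);
         f = fst (prod_decode r); g = snd (prod_decode r); gs = list_decode g
     in if t = 0 then y = 0
        else if t = 1 then xs \<noteq> [] \<and> y = Suc (hd xs)
        else if t = 2 then r < length xs \<and> y = hd (drop r xs)
        else if t = 3 then
          (\<exists>q\<in>set D. fst q = f \<and> snd (snd q) = y \<and> length (fst (snd q)) = length gs \<and>
             (\<forall>i<length gs. (hd (drop i gs), xs, hd (drop i (fst (snd q)))) \<in> set D))
        else if t = 4 then
          xs \<noteq> [] \<and>
          (if hd xs = 0 then (f, tl xs, y) \<in> set D
           else (\<exists>q\<in>set D. fst q = p \<and> fst (snd q) = (hd xs - 1) # tl xs \<and>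
                   (g, (hd xs - 1) # snd (snd q) # tl xs, y) \<in> set D))
        else (r, y # xs, 0) \<in> set D \<and>
          (\<forall>m<y. \<exists>q\<in>set D. fst q = r \<and> fst (snd q) = m # xs \<and> snd (snd q) \<noteq> 0))"

text \<open>The second component of the pair coded by \<open>s\<close> is a dummy: every fact is
  proposed at infinitely many stages, hence also after its premises have appeared.\<close>

definition fact_at :: "nat \<Rightarrow> fact" where
  "fact_at s =
    (let k = prod_decode (fst (prod_decode s)); l = prod_decode (snd k)
     in (fst k, list_decode (fst l), snd l))"

definition facts :: "nat \<Rightarrow> fact list" where
  "facts = rec_nat [] (\<lambda>s D.
     if justified D (fst (fact_at s)) (fst (snd (fact_at s))) (snd (snd (fact_at s)))
     then fact_at s # D else D)"

lemma computable_facts [computable_intros]: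
  "computable f \<Longrightarrow> computable (\<lambda>x. facts (f x))"
  unfolding facts_def fact_at_def justified_def Let_def
  by (rule computable_compose[of _ f]) (intro computable_intros)

lemma facts_Suc:
  "facts (Suc s) =
    (if justified (facts s) (fst (fact_at s)) (fst (snd (fact_at s))) (snd (snd (fact_at s)))
     then fact_at s # facts s else facts s)"
  by (simp add: facts_def)

lemma facts_0 [simp]: "facts 0 = []"
  by (simp add: facts_def)

lemma facts_extend: "s \<le> s' \<Longrightarrow> \<exists>E. facts s' = E @ facts s"
proof (induction rule: dec_induct)
  case (step n)
  then show ?case
    by (auto simp: facts_Suc)
qed simp

lemma facts_mono: "s \<le> s' \<Longrightarrow> set (facts s) \<subseteq> set (facts s')"
  using facts_extend by fastforce

text \<open>Membership in \<open>D\<close> occurs only positively in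
  \<open>justified\<close>.\<close>

lemma justified_mono:
  assumes "set D \<subseteq> set E" "justified D p xs y"
  shows "justified E p xs y"
proof -
  note D = subsetD[OF assms(1)]
  show ?thesis
    using assms(2) unfolding justified_def Let_def
    by (simp split: if_split_asm) (meson D)+
qed

text \<open>With \<open>s\<close> as dummy component, the fact is proposed at a stage
  \<open>s' \<ge> s\<close>, where it is still justified.\<close>

lemma justified_imp_fact:
  assumes "justified (facts s) p xs y"
  shows "\<exists>s. (p, xs, y) \<in> set (facts s)"
proof -
  define s' where "s' = prod_encode (prod_encode (p, prod_encode (list_encode xs, y)), s)"
  have "fact_at s' = (p, xs, y)"
    by (simp add: s'_def fact_at_def)
  moreover have "justified (facts s') p xs y"
    using assms facts_mono[of s s'] le_prod_encode_2 unfolding s'_def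
    by (blast intro: justified_mono)
  ultimately have "(p, xs, y) \<in> set (facts (Suc s'))"
    by (simp add: facts_Suc)
  then show ?thesis by blast
qed

lemma finite_subset_facts:
  assumes "finite A" "\<And>q. q \<in> A \<Longrightarrow> \<exists>s. q \<in> set (facts s)"
  shows "\<exists>s. A \<subseteq> set (facts s)"
  using assms
proof (induction A)
  case (insert q A)
  then obtain s t where "q \<in> set (facts s)" "A \<subseteq> set (facts t)"
    by blast
  then have "insert q A \<subseteq> set (facts (max s t))"
    using facts_mono[of s "max s t"] facts_mono[of t "max s t"] by auto
  then show ?case by blast
qed simp

section \<open>Completeness and soundness of the enumeration\<close>

text \<open>The finitely many premises of the last evaluation rule appear by a common stage and
  justify its conclusion.\<close>

lemma eval_imp_fact: "eval p xs y \<Longrightarrow> \<exists>s. (code p, xs, y) \<in> set (facts s)"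
proof (induction rule: eval.induct)
  case (eval_Zero xs)
  show ?case by (rule justified_imp_fact[of 0]) (simp add: justified_def)
next
  case (eval_Succ x xs)
  show ?case by (rule justified_imp_fact[of 0]) (simp add: justified_def)
next
  case (eval_Proj i xs)
  then show ?case
    by (intro justified_imp_fact[of 0]) (simp add: justified_def hd_drop_conv_nth)
next
  case (eval_Comp xs gs ys f z)
  let ?A = "insert (code f, ys, z) ((\<lambda>i. (code (gs ! i), xs, ys ! i)) ` {..<length gs})"
  have len: "length ys = length gs"
    using eval_Comp(1) by (simp add: list_all2_lengthD)
  have "\<exists>s. ?A \<subseteq> set (facts s)"
    using eval_Comp by (intro finite_subset_facts) (auto simp: list_all2_conv_all_nth)
  then obtain s where s: "?A \<subseteq> set (facts s)" ..
  have "justified (facts s) (code (Comp f gs)) xs z"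
    unfolding justified_def Let_def using s
    by (auto simp: len hd_drop_conv_nth intro!: bexI[of _ "(code f, ys, z)"])
  then show ?case by (rule justified_imp_fact)
next
  case (eval_Prec0 f xs y g)
  then obtain s where "(code f, xs, y) \<in> set (facts s)"
    by blast
  then have "justified (facts s) (code (Prec f g)) (0 # xs) y"
    by (simp add: justified_def)
  then show ?case by (rule justified_imp_fact)
next
  case (eval_PrecS f g n xs y z)
  let ?A = "{(code (Prec f g), n # xs, y), (code g, n # y # xs, z)}"
  have "\<exists>s. ?A \<subseteq> set (facts s)"
    using eval_PrecS by (intro finite_subset_facts) auto
  then obtain s where s: "?A \<subseteq> set (facts s)" ..
  then have "justified (facts s) (code (Prec f g)) (Suc n # xs) z"
    by (auto simp: justified_def Let_def intro!: bexI[of _ "(code (Prec f g), n # xs, y)"])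
  then show ?case by (rule justified_imp_fact)
next
  case (eval_Mu f n xs)
  then obtain v where v: "\<And>m. m < n \<Longrightarrow> \<exists>s. (code f, m # xs, Suc (v m)) \<in> set (facts s)"
    by metis
  let ?A = "insert (code f, n # xs, 0) ((\<lambda>m. (code f, m # xs, Suc (v m))) ` {..<n})"
  have "\<exists>s. ?A \<subseteq> set (facts s)"
    using eval_Mu v by (intro finite_subset_facts) auto
  then obtain s where s: "?A \<subseteq> set (facts s)" ..
  have "\<exists>q\<in>set (facts s). fst q = code f \<and> fst (snd q) = m # xs \<and> snd (snd q) \<noteq> 0"
    if "m < n" for m
    using s that by (intro bexI[of _ "(code f, m # xs, Suc (v m))"]) auto
  with s have "justified (facts s) (code (Mu f)) xs n"
    by (simp add: justified_def)
  then show ?case by (rule justified_imp_fact)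
qed

text \<open>A fact new at stage \<open>Suc s\<close> was justified by facts of stage
  \<open>s\<close>, and the tag of \<open>code p\<close> tells which evaluation rule
  applies.\<close>

lemma fact_imp_eval: "(code p, xs, y) \<in> set (facts s) \<Longrightarrow> eval p xs y"
proof (induction s arbitrary: p xs y)
  case (Suc s)
  let ?D = "set (facts s)"
  have IH: "\<And>p xs y. (code p, xs, y) \<in> ?D \<Longrightarrow> eval p xs y"
    by (rule Suc.IH)
  show ?case
  proof (cases "(code p, xs, y) \<in> ?D")
    case False
    with Suc.prems have "fact_at s = (code p, xs, y)"
      and "justified (facts s) (fst (fact_at s)) (fst (snd (fact_at s))) (snd (snd (fact_at s)))"
      by (auto simp: facts_Suc split: if_splits)
    then have j: "justified (facts s) (code p) xs y"
      by simp
    show ?thesis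
    proof (cases p)
      case Zero
      with j show ?thesis by (auto simp: justified_def intro: eval_Zero)
    next
      case Succ
      with j show ?thesis by (cases xs) (auto simp: justified_def intro: eval_Succ)
    next
      case (Proj i)
      with j show ?thesis
        by (auto simp: justified_def hd_drop_conv_nth intro: eval_Proj)
    next
      case (Comp f gs)
      with j obtain ys where ys: "(code f, ys, y) \<in> ?D" "length ys = length gs"
        and "\<forall>i<length gs. (hd (drop i (map code gs)), xs, hd (drop i ys)) \<in> ?D"
        by (auto simp: justified_def)
      then have "\<forall>i<length gs. (code (gs ! i), xs, ys ! i) \<in> ?D"
        by (simp add: hd_drop_conv_nth)
      with ys show ?thesis
        unfolding Comp by (intro eval_Comp[of _ _ ys]) (auto intro: IH simp: list_all2_conv_all_nth)
    next
      case (Prec f g)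
      with j obtain n zs where xs: "xs = n # zs"
        by (cases xs) (auto simp: justified_def)
      show ?thesis
      proof (cases n)
        case 0
        with j Prec xs show ?thesis by (auto simp: justified_def intro: eval_Prec0 IH)
      next
        case (Suc m)
        with j Prec xs obtain v where "(code p, m # zs, v) \<in> ?D" "(code g, m # v # zs, y) \<in> ?D"
          by (auto simp: justified_def Let_def)
        then have "eval p (m # zs) v" "eval g (m # v # zs) y"
          by (auto intro: IH)
        with Suc Prec xs show ?thesis by (auto intro: eval_PrecS)
      qed
    next
      case (Mu f)
      with j have "(code f, y # xs, 0) \<in> ?D"
        and 1: "\<forall>m<y. \<exists>q\<in>?D. fst q = code f \<and> fst (snd q) = m # xs \<and> snd (snd q) \<noteq> 0"
        by (simp_all add: justified_def Let_def)
      moreover have "\<exists>v. eval f (m # xs) (Suc v)" if "m < y" for m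
      proof -
        from 1 that obtain v where "(code f, m # xs, v) \<in> ?D" "v \<noteq> 0"
          by fastforce
        then show ?thesis using IH by (metis not0_implies_Suc)
      qed
      ultimately show ?thesis unfolding Mu by (intro eval_Mu) (auto intro: IH)
    qed
  qed (rule Suc.IH)
qed simp

section \<open>The coloring\<close>

text \<open>On codes of sets this removes all elements below \<open>r\<close>; the arithmetic form
  makes it visibly computable.\<close>

definition upper_part :: "nat \<Rightarrow> nat \<Rightarrow> nat" where
  "upper_part r n = n div 2 ^ r * 2 ^ r"

text \<open>For \<open>n \<noteq> 0\<close> this is the maximum of the set coded by
  \<open>n\<close>.\<close>

definition top_bit :: "nat \<Rightarrow> nat" where
  "top_bit n = (LEAST i. n < 2 ^ Suc i)"

text \<open>Only the first component of the pair coded by \<open>r\<close> names a program; the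
  second provides arbitrarily large \<open>r\<close> for the same program.\<close>

definition accepts :: "nat \<Rightarrow> fact \<Rightarrow> bool" where
  "accepts r q \<longleftrightarrow> fst q = fst (prod_decode r) \<and> length (fst (snd q)) = 1 \<and>
     hd (fst (snd q)) \<noteq> 0 \<and> upper_part r (hd (fst (snd q))) = hd (fst (snd q))"

text \<open>
  The requirement \<open>r = \<langle>e, k\<rangle>\<close> is met by the first nonempty set with minimum at least \<open>r\<close> that
  the \<open>e\<close>-th program is seen to accept. Its code is \<open>target r s\<close> if it has appeared by stage
  \<open>s\<close>, and \<open>target r s = 0\<close> (the code of the empty set) before that.
\<close>

definition target :: "nat \<Rightarrow> nat \<Rightarrow> nat" where
  "target r s = fold (\<lambda>q a. if accepts r q then hd (fst (snd q)) else a) (facts s) 0"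

text \<open>The value 0 stands for no matching target. The alternative \<open>r = y\<close> ensures
  that the least number exists and restricts the search to \<open>r < y\<close>.\<close>

definition mark :: "nat \<Rightarrow> nat \<Rightarrow> nat" where
  "mark z y =
    (let r = LEAST r. r = y \<or> (target r y \<noteq> 0 \<and> target r y = upper_part r z)
     in if r = y then 0 else target r y)"

text \<open>Course-of-values step: \<open>l\<close> holds the earlier counts, \<open>m\<close> is
  the maximum of the set coded by \<open>n\<close>, and \<open>k\<close> codes the rest. The last
  gap is tested with \<open>m\<close> as the stage; \<open>k = 0\<close> means that there is no
  gap.\<close>

definition count_step :: "nat \<Rightarrow> nat list \<Rightarrow> nat" where
  "count_step n l =
    (let m = top_bit n; k = n - 2 ^ m; t = mark k m
     in if k = 0 then 0
        else hd (drop k l) + (if t \<noteq> 0 \<and> hd (drop t l) mod 3 = 0 then 1 else 0))"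

definition count_table :: "nat \<Rightarrow> nat list" where
  "count_table = rec_nat [] (\<lambda>n l. l @ [count_step n l])"

definition count :: "nat \<Rightarrow> nat" where
  "count n = count_step n (count_table n)"

lemma ex_less_power: "\<exists>i. (n::nat) < 2 ^ Suc i"
  by (meson less_exp less_SucI less_trans power_strict_increasing_iff lessI one_less_numeral_iff
      semiring_norm(76))

section \<open>Computability of the count\<close>

lemma computable_upper_part [computable_intros]:
  assumes "computable f" "computable g"
  shows "computable (\<lambda>x. upper_part (f x) (g x))"
  unfolding upper_part_def by (intro computable_intros assms)

lemma computable_top_bit [computable_intros]:
  "computable f \<Longrightarrow> computable (\<lambda>x. top_bit (f x))"
  unfolding top_bit_def
  by (rule computable_compose[of _ f]) (intro computable_intros ex_less_power)

lemma computable_target [computable_intros]: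
  assumes "computable f" "computable g"
  shows "computable (\<lambda>x. target (f x) (g x))"
  by (rule computable_curry[OF _ assms])
    (unfold target_def accepts_def, intro computable_intros)

lemma computable_mark [computable_intros]:
  assumes "computable f" "computable g"
  shows "computable (\<lambda>x. mark (f x) (g x))"
  by (rule computable_curry[OF _ assms])
    (unfold mark_def Let_def, intro computable_intros, auto)

lemma computable_count_step [computable_intros]:
  assumes "computable f" "computable g"
  shows "computable (\<lambda>x. count_step (f x) (g x))"
  by (rule computable_curry[OF _ assms])
    (unfold count_step_def Let_def, intro computable_intros)

lemma computable_count: "computable count"
proof -
  have "computable (\<lambda>n. count_step n (count_table n))"
    unfolding count_table_def by (intro computable_intros)
  then show ?thesis by (simp flip: count_def)
qed

section \<open>Persistence of targets and the recursion for the count\<close>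

lemma fold_overwrite:
  fixes v :: "'a \<Rightarrow> nat"
  assumes "\<And>x. P x \<Longrightarrow> v x \<noteq> 0"
  shows "fold (\<lambda>x a. if P x then v x else a) xs a =
    (let b = fold (\<lambda>x a. if P x then v x else a) xs 0 in if b = 0 then a else b)"
proof (induction xs arbitrary: a)
  case (Cons x xs)
  show ?case
    using assms[of x] by (simp add: Cons[of "v x"] Cons[of a] Let_def) auto
qed simp

lemma fold_overwrite_cases:
  fixes v :: "'a \<Rightarrow> nat"
  shows "fold (\<lambda>x a. if P x then v x else a) xs a = a \<or>
    (\<exists>x\<in>set xs. P x \<and> fold (\<lambda>x a. if P x then v x else a) xs a = v x)"
proof (induction xs arbitrary: a)
  case (Cons x xs)
  then show ?case
    by (cases "P x") force+
qed simp

lemma target_cases: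
  assumes "target r s \<noteq> 0"
  obtains q where "q \<in> set (facts s)" "accepts r q" "target r s = hd (fst (snd q))"
  using assms fold_overwrite_cases[of "accepts r" "\<lambda>q. hd (fst (snd q))" "facts s" 0]
  unfolding target_def by auto

lemma upper_part_target: "upper_part r (target r s) = target r s"
proof (cases "target r s = 0")
  case False
  then show ?thesis by (elim target_cases) (simp add: accepts_def)
qed (simp add: upper_part_def)

text \<open>New facts stand in front of \<open>facts s\<close>, so the fold meets the old ones
  later, and these overwrite whatever the new ones contributed.\<close>

lemma target_stable:
  assumes "target r s \<noteq> 0" "s \<le> s'"
  shows "target r s' = target r s"
proof -
  obtain E where E: "facts s' = E @ facts s"
    using facts_extend[OF assms(2)] by blast
  show ?thesis
    unfolding target_def E fold_append o_apply
    by (subst fold_overwrite) (use assms(1) in \<open>auto simp: accepts_def target_def Let_def\<close>)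
qed

lemma fold_overwrite_nonzero:
  fixes v :: "'a \<Rightarrow> nat"
  assumes "\<And>x. P x \<Longrightarrow> v x \<noteq> 0" "a \<noteq> 0 \<or> (\<exists>x\<in>set xs. P x)"
  shows "fold (\<lambda>x a. if P x then v x else a) xs a \<noteq> 0"
  using assms(2)
proof (induction xs arbitrary: a)
  case (Cons x xs)
  then show ?case
    using assms(1) by (cases "P x") auto
qed simp

lemma ex_target:
  assumes "eval p [n] y" "fst (prod_decode r) = code p" "n \<noteq> 0" "upper_part r n = n"
  shows "\<exists>s. target r s \<noteq> 0"
proof -
  obtain s where s: "(code p, [n], y) \<in> set (facts s)"
    using eval_imp_fact[OF assms(1)] by blast
  moreover have "accepts r (code p, [n], y)"
    using assms(2-4) by (simp add: accepts_def)
  ultimately have "target r s \<noteq> 0"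
    unfolding target_def
    by (intro fold_overwrite_nonzero disjI2 bexI[of _ "(code p, [n], y)"]) (auto simp: accepts_def)
  then show ?thesis ..
qed

lemma target_eval:
  assumes "target r s \<noteq> 0" "fst (prod_decode r) = code p"
  shows "\<exists>y. eval p [target r s] y"
proof -
  obtain q where q: "q \<in> set (facts s)" "accepts r q" "target r s = hd (fst (snd q))"
    using assms(1) by (rule target_cases)
  then have "q = (code p, [target r s], snd (snd q))"
    using assms(2)
    by (auto simp: accepts_def length_Suc_conv prod_eq_iff)
  with q(1) show ?thesis using fact_imp_eval by metis
qed

text \<open>Makes the recursion well-founded: the count of a mark is looked up in a table of smaller
  codes.\<close>

lemma mark_le: "mark z y \<le> z"
proof (cases "mark z y = 0")
  case False
  define r where "r = (LEAST r. r = y \<or> (target r y \<noteq> 0 \<and> target r y = upper_part r z))"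
  have "r = y \<or> (target r y \<noteq> 0 \<and> target r y = upper_part r z)"
    unfolding r_def by (rule LeastI[of _ y]) simp
  moreover have "mark z y = (if r = y then 0 else target r y)"
    by (simp add: mark_def r_def Let_def)
  ultimately show ?thesis
    using False by (auto simp: upper_part_def split: if_splits)
qed simp

lemma count_table: "count_table n = map count [0..<n]"
  by (induction n) (auto simp: count_table_def count_def)

lemma count_rec:
  "count n = (let m = top_bit n; k = n - 2 ^ m; t = mark k m
     in if k = 0 then 0 else count k + (if t \<noteq> 0 \<and> count t mod 3 = 0 then 1 else 0))"
proof -
  have nth: "hd (drop i (count_table n)) = count i" if "i < n" for i
    using that by (simp add: count_table hd_drop_conv_nth)
  show ?thesis
  proof (cases "n - 2 ^ top_bit n = 0")
    case False
    then have "n - 2 ^ top_bit n < n" by simp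
    moreover from this have "mark (n - 2 ^ top_bit n) (top_bit n) < n"
      using mark_le order.strict_trans1 by blast
    ultimately show ?thesis
      by (simp add: count_def[of n] count_step_def Let_def nth)
  qed (simp add: count_def count_step_def Let_def)
qed

section \<open>Binary codes of finite sets\<close>

lemma set_decode_upper_part: "set_decode (upper_part r n) = set_decode n \<inter> {r..}"
proof -
  have "upper_part r n = push_bit r (drop_bit r n)"
    by (simp add: upper_part_def push_bit_eq_mult drop_bit_eq_div)
  moreover have "i \<in> set_decode m \<longleftrightarrow> bit m i" for i m
    by (simp add: set_decode_def bit_iff_odd)
  ultimately show ?thesis
    by (auto simp: bit_push_bit_iff bit_drop_bit_eq)
qed

lemma upper_part_set_encode:
  "finite Z \<Longrightarrow> upper_part r (set_encode Z) = set_encode (Z \<inter> {r..})"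
  by (metis set_decode_inverse set_decode_upper_part set_encode_inverse)

lemma set_encode_eq_0_iff: "finite Z \<Longrightarrow> set_encode Z = 0 \<longleftrightarrow> Z = {}"
  by (metis set_encode_empty set_encode_inverse set_decode_zero)

lemma set_encode_less_power:
  assumes "Z \<subseteq> {..<y}"
  shows "set_encode Z < 2 ^ y"
proof -
  have "set_encode Z \<le> (\<Sum>i<y. 2 ^ i)"
    unfolding set_encode_def using assms by (intro sum_mono2) auto
  also have "\<dots> < 2 ^ y"
    by (induction y) auto
  finally show ?thesis .
qed

lemma top_bit_insert:
  assumes "Z \<subseteq> {..<y}"
  shows "top_bit (2 ^ y + set_encode Z) = y"
  unfolding top_bit_def
proof (rule Least_equality)
  show "2 ^ y + set_encode Z < 2 ^ Suc y"
    using set_encode_less_power[OF assms] by simp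
  fix i assume "2 ^ y + set_encode Z < 2 ^ Suc i"
  then have "(2::nat) ^ y < 2 ^ Suc i" by linarith
  then show "y \<le> i" by (simp add: power_strict_increasing_iff less_Suc_eq_le del: power_Suc)
qed

section \<open>Weights of single gaps\<close>

text \<open>
  \<open>hits X\<close> is the sum of \<open>weight (X \<inter> {..x}) y\<close> over the pairs \<open>x < y\<close> of consecutive elements of \<open>X\<close>.
\<close>

definition hits :: "nat set \<Rightarrow> nat" where
  "hits X = count (set_encode X)"

definition weight :: "nat set \<Rightarrow> nat \<Rightarrow> nat" where
  "weight Z y =
    (let t = mark (set_encode Z) y in if t \<noteq> 0 \<and> count t mod 3 = 0 then 1 else 0)"

lemma weight_le_1: "weight Z y \<le> 1"
  by (simp add: weight_def Let_def)

lemma hits_insert: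
  assumes "finite Z" "Z \<subseteq> {..<y}"
  shows "hits (insert y Z) = (if Z = {} then 0 else hits Z + weight Z y)"
proof -
  have "y \<notin> Z" using assms(2) by auto
  with assms have "set_encode (insert y Z) = 2 ^ y + set_encode Z"
    by simp
  then show ?thesis
    using assms
    by (simp add: hits_def weight_def count_rec[of "2 ^ y + set_encode Z"] top_bit_insert
        set_encode_eq_0_iff Let_def)
qed

text \<open>\<open>mark\<close> looks at a set only by testing which targets agree with its upper
  parts.\<close>

lemma weight_cong:
  assumes "finite Z" "finite Z'"
    and "\<And>r. target r y \<noteq> 0 \<Longrightarrow>
      set_decode (target r y) = Z \<inter> {r..} \<longleftrightarrow> set_decode (target r y) = Z' \<inter> {r..}"
  shows "weight Z y = weight Z' y"
proof -
  have eq: "target r y = upper_part r (set_encode X) \<longleftrightarrow> set_decode (target r y) = X \<inter> {r..}"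
    if "finite X" for r X
    using that by (metis finite_Int set_decode_inverse set_encode_inverse upper_part_set_encode)
  have "target r y \<noteq> 0 \<and> target r y = upper_part r (set_encode Z) \<longleftrightarrow>
      target r y \<noteq> 0 \<and> target r y = upper_part r (set_encode Z')" for r
    using assms by (auto simp: eq)
  then have "mark (set_encode Z) y = mark (set_encode Z') y"
    unfolding mark_def by presburger
  then show ?thesis by (simp add: weight_def)
qed

text \<open>The least matching index may be below \<open>r\<close>, but \<open>T\<close> has no
  element below \<open>r\<close>, so the target matched there is again all of
  \<open>T\<close>.\<close>

lemma weight_target:
  assumes "finite T" "T \<noteq> {}" "target r s = set_encode T" "s \<le> y" "r < y"
  shows "weight T y = (if hits T mod 3 = 0 then 1 else 0)"
proof -
  let ?P = "\<lambda>r. r = y \<or> (target r y \<noteq> 0 \<and> target r y = upper_part r (set_encode T))"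
  have nz: "set_encode T \<noteq> 0"
    using assms by (simp add: set_encode_eq_0_iff)
  then have ty: "target r y = set_encode T"
    using target_stable[of r s y] assms by simp
  have up: "upper_part r (set_encode T) = set_encode T"
    using upper_part_target[of r y] ty by simp
  have "?P r" using ty nz up by simp
  then have "?P (Least ?P)" "Least ?P \<le> r"
    by (rule LeastI, rule Least_le)
  moreover from this have "T \<subseteq> {Least ?P..}"
  proof -
    have "T \<inter> {r..} = T"
      using up assms(1) by (metis finite_Int set_encode_inverse upper_part_set_encode)
    then have "T \<subseteq> {r..}" by blast
    then show ?thesis using \<open>Least ?P \<le> r\<close> by fastforce
  qed
  then have "T \<inter> {Least ?P..} = T" by blast
  ultimately have "mark (set_encode T) y = set_encode T"
    using assms(1,5) by (simp add: mark_def Let_def upper_part_set_encode)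
  then show ?thesis using nz by (simp add: weight_def hits_def)
qed

section \<open>Additivity\<close>

text \<open>Any element from \<open>M\<close> on rules out agreement with a target of index at most
  \<open>N\<close>, at every stage.\<close>

definition settled :: "nat \<Rightarrow> nat \<Rightarrow> bool" where
  "settled N M \<longleftrightarrow> N < M \<and> (\<forall>r\<le>N. \<forall>s. set_decode (target r s) \<subseteq> {..<M})"

text \<open>By \<open>target_stable\<close> each index has at most one nonzero target, so finitely
  many finite sets have to be bounded.\<close>

lemma ex_settled: "\<exists>M. settled N M"
proof -
  have "\<exists>M. \<forall>s. set_decode (target r s) \<subseteq> {..<M}" for r
  proof (cases "\<exists>s. target r s \<noteq> 0")
    case True
    then obtain s0 where s0: "target r s0 \<noteq> 0" ..
    have "target r s = 0 \<or> target r s = target r s0" for s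
      using target_stable[OF s0, of s] target_stable[of r s s0] nat_le_linear by metis
    moreover obtain M where "\<forall>x\<in>set_decode (target r s0). x < M"
      using finite_nat_set_iff_bounded finite_set_decode by blast
    ultimately show ?thesis
      by (intro exI[of _ M]) (metis empty_subsetI lessThan_iff set_decode_zero subsetI)
  qed auto
  then obtain m where m: "\<And>r s. set_decode (target r s) \<subseteq> {..<m r}"
    by metis
  have "m r \<le> Suc (N + Max (m ` {..N}))" if "r \<le> N" for r
    using that by (simp add: le_SucI trans_le_add2)
  with m have "settled N (Suc (N + Max (m ` {..N})))"
    unfolding settled_def by (meson lessThan_subset_iff less_Suc_eq_le le_add1 order_trans)
  then show ?thesis ..
qed

text \<open>For \<open>r \<le> N\<close> an element of \<open>T\<close> from \<open>M\<close> on
  makes both comparisons fail; for \<open>r > N\<close> cutting at \<open>r\<close> removes all of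
  \<open>B\<close>.\<close>

lemma weight_union:
  assumes "settled N M" "B \<subseteq> {..N}" "finite T" "T \<noteq> {}" "T \<subseteq> {M..}"
  shows "weight (B \<union> T) y = weight T y"
proof (rule weight_cong)
  fix r
  obtain t where t: "t \<in> T" "M \<le> t"
    using assms(4,5) by auto
  show "set_decode (target r y) = (B \<union> T) \<inter> {r..} \<longleftrightarrow> set_decode (target r y) = T \<inter> {r..}"
  proof (cases "r \<le> N")
    case True
    then have "t \<notin> set_decode (target r y)" "r \<le> t"
      using assms(1) t(2) unfolding settled_def by fastforce+
    with t show ?thesis by auto
  next
    case False
    then have "(B \<union> T) \<inter> {r..} = T \<inter> {r..}"
      using assms(2) by auto
    then show ?thesis by simp
  qed
qed (use assms finite_subset in auto)

text \<open>Add the elements of \<open>T\<close> in increasing order. The first one closes the gap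
  after \<open>B\<close>; each later gap weighs the same with or without \<open>B\<close>.\<close>

lemma hits_union:
  assumes "settled N M" "B \<noteq> {}" "B \<subseteq> {..N}" "finite T" "T \<noteq> {}" "T \<subseteq> {M..}"
  shows "hits (B \<union> T) = hits B + weight B (Min T) + hits T"
  using assms(4-6)
proof (induction T rule: finite_linorder_max_induct)
  case (insert b A)
  have B: "finite B" "B \<subseteq> {..<b}"
    using assms(1,3) insert.prems finite_subset by (auto simp: settled_def)
  show ?case
  proof (cases "A = {}")
    case True
    then show ?thesis using B assms(2) hits_insert[of "{}" b] by (simp add: hits_insert)
  next
    case False
    have "Min (insert b A) = Min A"
      using insert.hyps False by (simp add: min_def) (meson Min_in leD)
    moreover have "weight (B \<union> A) b = weight A b"
      using assms(1,3) insert False by (intro weight_union) auto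
    moreover have "hits (insert b (B \<union> A)) = hits (B \<union> A) + weight (B \<union> A) b"
      using insert.hyps B False by (subst hits_insert) auto
    moreover have "hits (insert b A) = hits A + weight A b"
      using insert.hyps False by (subst hits_insert) auto
    ultimately show ?thesis
      using insert False by simp
  qed
qed simp

section \<open>Defeating full matches\<close>

text \<open>If \<open>a\<close> is not 1 modulo 3, then \<open>a + v a\<close> is 1 (from 0) or 2
  (from 2); likewise for \<open>b\<close>. For \<open>y\<close> of residue 0 an increment 1 is
  wanted, available singly or as 2 + 2; for residue 2 an increment 2, available singly or as 1 +
  1.\<close>

lemma ex_residue_1:
  fixes a b y :: nat
  defines "v \<equiv> \<lambda>n. if n mod 3 = 0 then 1 else 0 :: nat"
  shows "a mod 3 = 1 \<or> b mod 3 = 1 \<or> y mod 3 = 1 \<or> (a + v a + y) mod 3 = 1 \<or>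
    (b + v b + y) mod 3 = 1 \<or> ((a + v a + b) + v b + y) mod 3 = 1"
proof -
  have res: "n mod 3 = 0 \<and> v n = 1 \<or> n mod 3 = 1 \<or> n mod 3 = 2 \<and> v n = 0" for n
    unfolding v_def by presburger
  have sums: "(a + v a + y) mod 3 = (a mod 3 + v a + y mod 3) mod 3"
    "(b + v b + y) mod 3 = (b mod 3 + v b + y mod 3) mod 3"
    "((a + v a + b) + v b + y) mod 3 = (a mod 3 + v a + b mod 3 + v b + y mod 3) mod 3"
    by (intro mod_add_cong; simp)+
  show ?thesis
    unfolding sums using res[of a] res[of b] res[of y] by (elim disjE conjE) simp_all
qed

lemma ex_good_set:
  assumes S: "\<And>T. T \<in> S \<Longrightarrow> finite T"
    and hit: "\<And>m. \<exists>r\<ge>m. \<exists>s. target r s \<noteq> 0 \<and> target r s \<in> set_encode ` S"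
  obtains T where "T \<in> NU S" "finite T" "T \<subseteq> {m..}" "hits T mod 3 = 1"
proof -
  have pick: "\<exists>r s T. m \<le> r \<and> T \<in> S \<and> finite T \<and> T \<noteq> {} \<and> T \<subseteq> {r..} \<and> target r s = set_encode T" for m
  proof -
    obtain r s T where *: "m \<le> r" "T \<in> S" "target r s \<noteq> 0" "target r s = set_encode T"
      using hit[of m] by auto
    moreover from this have "finite T" "T \<noteq> {}"
      using S by auto
    moreover from this * have "T \<inter> {r..} = T"
      using upper_part_target[of r s]
      by (metis finite_Int set_encode_inverse upper_part_set_encode)
    ultimately show ?thesis by blast
  qed
  obtain r1 s1 T1 where T1: "m \<le> r1" "T1 \<in> S" "finite T1" "T1 \<noteq> {}" "T1 \<subseteq> {r1..}"
    "target r1 s1 = set_encode T1"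
    using pick[of m] by blast
  \<comment> \<open>Bounding also the stage and the index of its target makes \<open>T1\<close>
    recognized at every gap from \<open>T1\<close> to a point beyond \<open>n1\<close>.\<close>
  obtain n1 where n1: "T1 \<subseteq> {..n1}" "s1 \<le> n1" "r1 \<le> n1"
    by (metis T1(3) Max_ge atMost_iff max.coboundedI1 max.coboundedI2 max.cobounded1 max.cobounded2 subsetI)
  obtain m1 where m1: "settled n1 m1"
    using ex_settled by blast
  obtain r2 s2 T2 where T2: "m1 \<le> r2" "T2 \<in> S" "finite T2" "T2 \<noteq> {}" "T2 \<subseteq> {r2..}"
    "target r2 s2 = set_encode T2"
    using pick[of m1] by blast
  obtain n2 where n2: "T2 \<subseteq> {..n2}" "s2 \<le> n2" "r2 \<le> n2"
    by (metis T2(3) Max_ge atMost_iff max.coboundedI1 max.coboundedI2 max.cobounded1 max.cobounded2 subsetI)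
  obtain m2 where m2: "settled n2 m2"
    using ex_settled by blast
  obtain r3 Y where Y: "m2 \<le> r3" "Y \<in> S" "finite Y" "Y \<noteq> {}" "Y \<subseteq> {r3..}"
    using pick[of m2] by blast
  have lt: "n1 < m1" "n2 < m2"
    using m1 m2 by (auto simp: settled_def)
  have T12: "T1 \<union> T2 \<subseteq> {..n2}"
    using n1 n2 T2 lt by auto
  let ?v = "\<lambda>T. if hits T mod 3 = 0 then 1 else 0 :: nat"
  have minY: "m2 \<le> Min Y" and min2: "m1 \<le> Min T2"
    using T2 Y by auto
  have sub: "T1 \<subseteq> {..n2}" "T2 \<subseteq> {m1..}" "Y \<subseteq> {m2..}" and m12: "m1 \<le> m2"
    using T12 T2 Y n2 lt by auto
  have v1: "weight T1 y = ?v T1" if "m1 \<le> y" for y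
    using T1 n1 lt that by (intro weight_target[of _ r1 s1]) auto
  have v2: "weight T2 (Min Y) = ?v T2"
    using T2 n2 lt minY by (intro weight_target[of _ r2 s2]) auto
  have h1: "hits (T1 \<union> Y) = hits T1 + ?v T1 + hits Y"
    using hits_union[OF m2 T1(4) sub(1) Y(3,4) sub(3)] v1[OF order.trans[OF m12 minY]] by simp
  have h2: "hits (T2 \<union> Y) = hits T2 + ?v T2 + hits Y"
    using hits_union[OF m2 T2(4) n2(1) Y(3,4) sub(3)] v2 by simp
  have h3: "hits (T1 \<union> T2 \<union> Y) = (hits T1 + ?v T1 + hits T2) + ?v T2 + hits Y"
  proof -
    have "hits (T1 \<union> T2) = hits T1 + ?v T1 + hits T2"
      using hits_union[OF m1 T1(4) n1(1) T2(3,4) sub(2)] v1[OF min2] by simp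
    \<comment> \<open>\<open>T2\<close> lies beyond the bound settled for \<open>T1\<close>, so the
      gap before \<open>Y\<close> does not notice \<open>T1\<close>.\<close>
    moreover have "weight (T1 \<union> T2) (Min Y) = ?v T2"
      using weight_union[OF m1 n1(1) T2(3,4) sub(2)] v2 by simp
    moreover have "T1 \<union> T2 \<noteq> {}"
      using T1(4) by simp
    ultimately show ?thesis
      using hits_union[OF m2 _ T12 Y(3,4) sub(3)] by simp
  qed
  have lt12: "\<forall>a\<in>T1. \<forall>b\<in>T2. a < b" and ltY: "\<forall>a\<in>T1 \<union> T2. \<forall>b\<in>Y. a < b"
    using n1 T2 lt T12 Y by fastforce+
  have NU: "T1 \<in> NU S" "T2 \<in> NU S" "Y \<in> NU S" "T1 \<union> Y \<in> NU S" "T2 \<union> Y \<in> NU S"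
    "T1 \<union> T2 \<union> Y \<in> NU S"
    unfolding NU_def using T1 T2 Y lt12 ltY
    by (auto intro: exI[of _ "[T1]"] exI[of _ "[T2]"] exI[of _ "[Y]"] exI[of _ "[T1, Y]"]
        exI[of _ "[T2, Y]"] exI[of _ "[T1, T2, Y]"])
  have low: "T1 \<subseteq> {m..}" "T2 \<subseteq> {m..}" "Y \<subseteq> {m..}"
    using T1 n1 T2 n2 Y lt by auto
  have "hits T1 mod 3 = 1 \<or> hits T2 mod 3 = 1 \<or> hits Y mod 3 = 1 \<or> hits (T1 \<union> Y) mod 3 = 1 \<or>
      hits (T2 \<union> Y) mod 3 = 1 \<or> hits (T1 \<union> T2 \<union> Y) mod 3 = 1"
    unfolding h1 h2 h3 by (rule ex_residue_1)
  then show thesis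
    using that NU low T1(3) T2(3) Y(3) by (metis Un_least finite_UnI)
qed

section \<open>Targets inside a c.e. family\<close>

text \<open>Each \<open>i < m\<close> lies in at most one member of \<open>D\<close>, so only
  finitely many members meet \<open>{..<m}\<close>.\<close>

lemma ex_disjoint_above:
  fixes D :: "nat set set"
  assumes "infinite D" "pairwise disjnt D"
  obtains T where "T \<in> D" "T \<noteq> {}" "T \<subseteq> {m..}"
proof -
  have "finite {T \<in> D. T \<inter> {..<m} \<noteq> {}}"
  proof (rule finite_subset)
    show "{T \<in> D. T \<inter> {..<m} \<noteq> {}} \<subseteq> (\<lambda>i. THE T. T \<in> D \<and> i \<in> T) ` {..<m}"
    proof
      fix T assume "T \<in> {T \<in> D. T \<inter> {..<m} \<noteq> {}}"
      then obtain i where i: "T \<in> D" "i \<in> T" "i < m" by auto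
      then have "(THE T. T \<in> D \<and> i \<in> T) = T"
        using assms(2) by (intro the_equality) (auto simp: pairwise_def disjnt_iff)
      with i show "T \<in> (\<lambda>i. THE T. T \<in> D \<and> i \<in> T) ` {..<m}" by force
    qed
  qed simp
  then have "infinite (D - insert {} {T \<in> D. T \<inter> {..<m} \<noteq> {}})"
    using assms(1) by (simp add: Diff_infinite_finite)
  then have "D - insert {} {T \<in> D. T \<inter> {..<m} \<noteq> {}} \<noteq> {}"
    by (rule infinite_imp_nonempty)
  then obtain T where "T \<in> D - insert {} {T \<in> D. T \<inter> {..<m} \<noteq> {}}"
    by blast
  then show thesis
    by (intro that[of T]) (auto simp: disjoint_iff not_less[symmetric])
qed

lemma ce_family_target:
  assumes "ce_family S" "D \<subseteq> S" "infinite D" "pairwise disjnt D"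
  shows "\<exists>r\<ge>m. \<exists>s. target r s \<noteq> 0 \<and> target r s \<in> set_encode ` S"
proof -
  obtain p where p: "\<And>n. n \<in> set_encode ` S \<longleftrightarrow> (\<exists>y. eval p [n] y)"
    using assms(1) unfolding ce_family_def ce_set_def by blast
  \<comment> \<open>The first component selects the program for \<open>S\<close>; the second pushes
    \<open>r\<close> up to at least \<open>m\<close>.\<close>
  define r where "r = prod_encode (code p, m)"
  have r: "fst (prod_decode r) = code p" "m \<le> r"
    by (simp_all add: r_def le_prod_encode_2)
  obtain T where T: "T \<in> D" "T \<noteq> {}" "T \<subseteq> {r..}"
    using assms(3,4) by (rule ex_disjoint_above)
  have fin: "finite T"
    using T(1) assms(1,2) by (auto simp: ce_family_def)
  obtain y where "eval p [set_encode T] y"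
    using p T(1) assms(2) by blast
  moreover have "upper_part r (set_encode T) = set_encode T"
    using T(3) fin by (simp add: upper_part_set_encode inf.absorb1)
  ultimately obtain s where s: "target r s \<noteq> 0"
    using ex_target r(1) T(2) fin set_encode_eq_0_iff by blast
  \<comment> \<open>The target may differ from the code of \<open>T\<close>, but \<open>p\<close>
    halts on it, which places it in the family.\<close>
  then have "target r s \<in> set_encode ` S"
    using target_eval r(1) p by blast
  with r(2) s show ?thesis by blast
qed

section \<open>The coloring by residues of the hit count\<close>

definition gap_coloring :: "nat set \<Rightarrow> nat" where
  "gap_coloring X = (if hits X mod 3 = 1 then 1 else 0)"

lemma computable_gap_coloring: "computable_coloring gap_coloring"
proof -
  have "computable (\<lambda>n. if count n mod 3 = 1 then 1 else 0 :: nat)"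
    by (intro computable_intros computable_count)
  then have "computable_fun (\<lambda>n. if count n mod 3 = 1 then 1 else 0)"
    by (simp add: computable_def computable_fun_def)
  then show ?thesis
    unfolding computable_coloring_def gap_coloring_def hits_def by auto
qed

theorem theorem3p3:
  shows "\<exists>c. computable_coloring c \<and>
    (\<forall>\<B> S. finite \<B> \<and> (\<forall>B\<in>\<B>. finite B) \<and> ce_family S \<and>
       (\<exists>D\<subseteq>S. infinite D \<and> pairwise disjnt D)
       \<longrightarrow> \<not> full_matches c \<B> (NU S))"
proof (intro exI[of _ gap_coloring] conjI allI impI computable_gap_coloring; elim conjE exE)
  fix \<B> S D :: "nat set set"
  assume B: "finite \<B>" "\<forall>B\<in>\<B>. finite B"
    and S: "ce_family S" "D \<subseteq> S" "infinite D" "pairwise disjnt D"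
  \<comment> \<open>One bound for all members of \<open>\<B>\<close>, so that a single
    \<open>m\<close> serves every \<open>B\<close>.\<close>
  obtain N where N: "\<Union>\<B> \<subseteq> {..N}"
    using B finite_Union[of \<B>] finite_nat_set_iff_bounded_le by fastforce
  obtain m where m: "settled N m"
    using ex_settled by blast
  obtain T where T: "T \<in> NU S" "finite T" "T \<subseteq> {m..}" "hits T mod 3 = 1"
    using ex_good_set[of S m] ce_family_target[OF S] S(1) unfolding ce_family_def by blast
  have "\<not> full_matches_set gap_coloring \<B> T"
  proof
    assume "full_matches_set gap_coloring \<B> T"
    then obtain B where b: "B \<in> \<B>" "blk_less B T" "gap_coloring B = gap_coloring T"
      "gap_coloring T = gap_coloring (B \<union> T)"
      unfolding full_matches_set_def by blast
    then have "hits (B \<union> T) = hits B + weight B (Min T) + hits T"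
      using hits_union[OF m, of B T] N T by (auto simp: blk_less_def)
    moreover have "gap_coloring T = 1"
      using T(4) by (simp add: gap_coloring_def)
    then have "hits B mod 3 = 1" "hits (B \<union> T) mod 3 = 1"
      using b(3,4) by (metis gap_coloring_def zero_neq_one)+
    moreover have "weight B (Min T) = 0 \<or> weight B (Min T) = 1"
      using weight_le_1[of B "Min T"] by linarith
    \<comment> \<open>Residues 1 and 1 with a weight 0 or 1 add up to 2 or 0 modulo 3, never to
      1.\<close>
    ultimately show False using T(4) by (elim disjE; simp; presburger)
  qed
  with T(1) show "\<not> full_matches gap_coloring \<B> (NU S)"
    unfolding full_matches_def by blast
qed

end
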